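(* Assume $\lim_{n\to\infty}X'X/n=Q$ exists and is positive definite. Then: (1) $\lim_{M\to\infty}\sup_{n\ge k}\sup_{\beta\in\mathbb{R}^k}\mathbb{P}_{n,\beta,\sigma}\big(\sqrt n\|\tilde\beta-\beta\|\ge M\big)=0$; consequently, for every $\varepsilon>0$ and every sequence of reals $c_n\ge0$ with $c_n=o(n^{1/2})$, $\lim_{n\to\infty}\sup_{\beta\in\mathbb{R}^k}\mathbb{P}_{n,\beta,\sigma}(c_n\|\tilde\beta-\beta\|\ge\varepsilon)=0$ (in particular, with $c_n=1$, $\tilde\beta$ is uniformly consistent). (2) The same two statements hold with $\tilde\beta-\beta$ replaced by $A_n\tilde\beta-A_n\beta$, for any non-stochastic $p_n\times k$ matrices $A_n$ whose largest eigenvalues $\lambda_{\max}(A_n'A_n)$ are bounded in $n$.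
   Context: Setup: for each sample size $n$, $Y=X\beta+u$, where $Y$ is $n\times1$, $X$ is a non-stochastic $n\times k$ matrix of full column rank $k$ (so $n\ge k$), $k>1$, and $u\sim N(0,\sigma^2I_n)$ with $0<\sigma^2<\infty$ known and fixed. $\mathbb{P}_{n,\beta,\sigma}$ denotes the distribution of $Y$. Partition $X=[X_1:X_2]$ and $\beta=(\beta_1',\beta_2')'$ commensurably, with $X_i$ having $k_i\ge1$ columns. $\hat\beta(R)=\big(((X_1'X_1)^{-1}X_1'Y)',0_{1\times k_2}\big)'$, $\hat\beta(U)=(X'X)^{-1}X'Y$. For $\alpha>0$, $\tilde\beta=\hat\lambda\hat\beta(R)+(1-\hat\lambda)\hat\beta(U)$ with $\hat\lambda=\big[1+\exp(-2\alpha k_2)\exp(\alpha\|X\hat\beta(R)-X\hat\beta(U)\|^2/\sigma^2)\big]^{-1}$. *)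

theory Defs
  imports "HOL-Probability.Probability" "HOL-Library.Landau_Symbols"
    "Jordan_Normal_Form.Char_Poly" "Jordan_Normal_Form.DL_Rank"
    "Jordan_Normal_Form.Gauss_Jordan_Elimination"
begin

text \<open>Matrices and vectors of varying dimension are Jordan_Normal_Form matrices/vectors.
  Indices are 0-based: the block X1 consists of the first k1 columns of X.\<close>

definition minv :: "real mat \<Rightarrow> real mat" where
  "minv A = the (mat_inverse A)"

definition vnorm :: "real vec \<Rightarrow> real" where
  "vnorm v = sqrt (v \<bullet> v)"

definition Xfirst :: "nat \<Rightarrow> real mat \<Rightarrow> real mat" where
  "Xfirst k1 X = mat (dim_row X) k1 (\<lambda>(i,j). X $$ (i,j))"

definition betaU :: "real mat \<Rightarrow> real vec \<Rightarrow> real vec" where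
  "betaU X Y = minv (transpose_mat X * X) *\<^sub>v (transpose_mat X *\<^sub>v Y)"

definition betaR :: "nat \<Rightarrow> real mat \<Rightarrow> real vec \<Rightarrow> real vec" where
  "betaR k1 X Y = (let X1 = Xfirst k1 X;
                       b1 = minv (transpose_mat X1 * X1) *\<^sub>v (transpose_mat X1 *\<^sub>v Y)
                   in vec (dim_col X) (\<lambda>i. if i < k1 then b1 $ i else 0))"

text \<open>Weight lambda-hat; sigma is the standard deviation, so sigma^2 is the known variance.\<close>
definition lamhat :: "real \<Rightarrow> real \<Rightarrow> nat \<Rightarrow> real mat \<Rightarrow> real vec \<Rightarrow> real" where
  "lamhat \<alpha> \<sigma> k1 X Y =
     inverse (1 + exp (- 2 * \<alpha> * real (dim_col X - k1)) *
        exp (\<alpha> * (vnorm (X *\<^sub>v betaR k1 X Y - X *\<^sub>v betaU X Y))^2 / \<sigma>^2))"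

definition betaT :: "real \<Rightarrow> real \<Rightarrow> nat \<Rightarrow> real mat \<Rightarrow> real vec \<Rightarrow> real vec" where
  "betaT \<alpha> \<sigma> k1 X Y =
     lamhat \<alpha> \<sigma> k1 X Y \<cdot>\<^sub>v betaR k1 X Y + (1 - lamhat \<alpha> \<sigma> k1 X Y) \<cdot>\<^sub>v betaU X Y"

text \<open>Distribution P_{n,beta,sigma} of Y = X beta + u, u ~ N(0, sigma^2 I_n),
  as a product measure on (extensional) functions {..<n} -> real.\<close>
definition Pdist :: "nat \<Rightarrow> real mat \<Rightarrow> real vec \<Rightarrow> real \<Rightarrow> (nat \<Rightarrow> real) measure" where
  "Pdist n X \<beta> \<sigma> = PiM {..<n} (\<lambda>i. density lborel (normal_density ((X *\<^sub>v \<beta>) $ i) \<sigma>))"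

definition PrY :: "nat \<Rightarrow> real mat \<Rightarrow> real vec \<Rightarrow> real \<Rightarrow> (real vec \<Rightarrow> bool) \<Rightarrow> real" where
  "PrY n X \<beta> \<sigma> E = measure (Pdist n X \<beta> \<sigma>) {Y \<in> space (Pdist n X \<beta> \<sigma>). E (vec n Y)}"

definition pos_def_mat :: "nat \<Rightarrow> real mat \<Rightarrow> bool" where
  "pos_def_mat k Q \<longleftrightarrow> Q \<in> carrier_mat k k \<and> transpose_mat Q = Q \<and>
     (\<forall>v \<in> carrier_vec k. v \<noteq> 0\<^sub>v k \<longrightarrow> v \<bullet> (Q *\<^sub>v v) > 0)"

definition lambda_max :: "real mat \<Rightarrow> real" where
  "lambda_max A = Max {e. eigenvalue A e}"

end

theory Submission
  imports Defs
begin

text \<open>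
  Write \<open>d\<close> for the difference of the restricted and unrestricted estimators, so that the
  error of the averaged estimator is \<open>\<lambda> d\<close> plus the error of the unrestricted one.
  Since \<open>\<lambda>\<close> decays exponentially in \<open>|X d|\<^sup>2\<close>, the vector \<open>\<lambda> X d\<close> is bounded by a
  constant, deterministically and whatever \<open>\<beta>\<close> is; and \<open>|X v|\<^sup>2 \<ge> c n |v|\<^sup>2\<close> with the same
  \<open>c > 0\<close> for all \<open>n \<ge> k\<close>, so \<open>\<surd>n |\<lambda> d|\<close> is bounded too. For the unrestricted estimator the
  same inequality bounds the error by \<open>|X' u| / (c n)\<close>, and \<open>E |X' u|\<^sup>2 = \<sigma>\<^sup>2 tr (X' X) = O(n)\<close>
  does not depend on \<open>\<beta>\<close>; Markov's inequality finishes the argument. Part (2) is the Rayleigh bound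
  \<open>|A v|\<^sup>2 \<le> \<lambda>\<^sub>m\<^sub>a\<^sub>x(A' A) |v|\<^sup>2\<close>.
\<close>

no_notation inner (infix "\<bullet>" 70)

section \<open>Quadratic forms\<close>

lemma scalar_prod_self_nonneg: "0 \<le> v \<bullet> (v :: real vec)"
  by (auto simp: scalar_prod_def intro!: sum_nonneg)

lemma vnorm_power2: "(vnorm v)\<^sup>2 = v \<bullet> v"
  by (simp add: vnorm_def scalar_prod_self_nonneg)

lemma index_power2_le_scalar_prod:
  fixes v :: "real vec"
  assumes "i < dim_vec v"
  shows "(v $ i)\<^sup>2 \<le> v \<bullet> v"
  unfolding scalar_prod_def power2_eq_square
  using assms by (intro member_le_sum) auto

lemma scalar_prod_self_pos:
  fixes v :: "real vec"
  assumes "v \<in> carrier_vec n" "v \<noteq> 0\<^sub>v n"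
  shows "0 < v \<bullet> v"
proof -
  obtain i where "i < n" "v $ i \<noteq> 0"
    using assms by (metis carrier_vecD eq_vecI index_zero_vec)
  thus ?thesis
    using index_power2_le_scalar_prod[of i v] assms(1) by (smt (verit) carrier_vecD zero_less_power2)
qed

lemma scalar_prod_mult_mat_vec_eq_sum:
  fixes S :: "real mat"
  assumes "S \<in> carrier_mat m n" "x \<in> carrier_vec m" "y \<in> carrier_vec n"
  shows "x \<bullet> (S *\<^sub>v y) = (\<Sum>i<m. \<Sum>j<n. x $ i * S $$ (i,j) * y $ j)"
  using assms
  by (auto simp: scalar_prod_def sum_distrib_left lessThan_atLeast0 mult.assoc intro!: sum.cong)

text \<open>By 2|ab| \<le> a^2 + b^2, each of the n^2 terms is at most
  \<open>e * (x \<bullet> x)\<close>. Though crude, this turns entrywise closeness of matrices into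
  closeness of their quadratic forms.\<close>

lemma abs_quadratic_form_le:
  fixes S :: "real mat"
  assumes S: "S \<in> carrier_mat n n" and x: "x \<in> carrier_vec n"
    and e: "\<And>i j. i < n \<Longrightarrow> j < n \<Longrightarrow> \<bar>S $$ (i,j)\<bar> \<le> e"
  shows "\<bar>x \<bullet> (S *\<^sub>v x)\<bar> \<le> e * (real n)\<^sup>2 * (x \<bullet> x)"
proof -
  have bd: "\<bar>x $ i * S $$ (i,j) * x $ j\<bar> \<le> e * (x \<bullet> x)" if "i < n" "j < n" for i j
  proof -
    have "2 * \<bar>x $ i * x $ j\<bar> \<le> (x $ i)\<^sup>2 + (x $ j)\<^sup>2"
      using sum_squares_bound[of "\<bar>x $ i\<bar>" "\<bar>x $ j\<bar>"] by (simp add: abs_mult)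
    also have "\<dots> \<le> 2 * (x \<bullet> x)"
      using index_power2_le_scalar_prod[of i x] index_power2_le_scalar_prod[of j x] x that by auto
    finally have "\<bar>S $$ (i,j)\<bar> * \<bar>x $ i * x $ j\<bar> \<le> e * (x \<bullet> x)"
      using e[OF that] by (intro mult_mono) auto
    thus ?thesis by (simp add: abs_mult mult_ac)
  qed
  have "\<bar>x \<bullet> (S *\<^sub>v x)\<bar> \<le> (\<Sum>i<n. \<Sum>j<n. \<bar>x $ i * S $$ (i,j) * x $ j\<bar>)"
    unfolding scalar_prod_mult_mat_vec_eq_sum[OF S x x]
    by (intro order_trans[OF sum_abs] sum_mono order_refl)
  also have "\<dots> \<le> (\<Sum>i<n. \<Sum>j<n. e * (x \<bullet> x))"
    by (intro sum_mono bd) auto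
  also have "\<dots> = e * (real n)\<^sup>2 * (x \<bullet> x)" by (simp add: power2_eq_square)
  finally show ?thesis .
qed

lemma scalar_prod_transpose_mult_mat_vec:
  fixes A :: "real mat"
  assumes "A \<in> carrier_mat m n" "x \<in> carrier_vec n" "y \<in> carrier_vec n"
  shows "x \<bullet> ((transpose_mat A * A) *\<^sub>v y) = (A *\<^sub>v x) \<bullet> (A *\<^sub>v y)"
proof -
  have "x \<bullet> ((transpose_mat A * A) *\<^sub>v y) = (transpose_mat A *\<^sub>v (A *\<^sub>v y)) \<bullet> x"
    using assms by (subst comm_scalar_prod[of _ n]) (auto intro!: mult_mat_vec_carrier[of _ n m])
  also have "\<dots> = (A *\<^sub>v y) \<bullet> (A *\<^sub>v x)"
    using assms by (intro transpose_vec_mult_scalar) auto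
  also have "\<dots> = (A *\<^sub>v x) \<bullet> (A *\<^sub>v y)"
    using assms by (intro comm_scalar_prod[of _ m]) auto
  finally show ?thesis .
qed

lemma smult_mult_mat_vec:
  fixes A :: "real mat"
  assumes "A \<in> carrier_mat m n" "v \<in> carrier_vec n"
  shows "(a \<cdot>\<^sub>m A) *\<^sub>v v = a \<cdot>\<^sub>v (A *\<^sub>v v)"
  using assms by (intro eq_vecI) auto

lemma mult_mat_vec_bounded:
  fixes A :: "real mat"
  assumes A: "A \<in> carrier_mat m n"
  obtains C where "0 \<le> C" "\<And>x. x \<in> carrier_vec n \<Longrightarrow> (A *\<^sub>v x) \<bullet> (A *\<^sub>v x) \<le> C * (x \<bullet> x)"
proof -
  let ?S = "transpose_mat A * A"
  \<comment> \<open>The sum dominates every entry and, unlike a maximum, makes sense for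
    \<open>n = 0\<close>.\<close>
  define e where "e = (\<Sum>p\<in>{..<n}\<times>{..<n}. \<bar>?S $$ p\<bar>)"
  have S: "?S \<in> carrier_mat n n" using A by auto
  have "\<bar>?S $$ (i,j)\<bar> \<le> e" if "i < n" "j < n" for i j
    unfolding e_def using that by (intro member_le_sum) auto
  hence "\<bar>x \<bullet> (?S *\<^sub>v x)\<bar> \<le> e * (real n)\<^sup>2 * (x \<bullet> x)" if "x \<in> carrier_vec n" for x
    using abs_quadratic_form_le[OF S that] by blast
  hence "(A *\<^sub>v x) \<bullet> (A *\<^sub>v x) \<le> e * (real n)\<^sup>2 * (x \<bullet> x)" if "x \<in> carrier_vec n" for x
    using scalar_prod_transpose_mult_mat_vec[OF A that that] that by (metis abs_le_D1)
  moreover have "0 \<le> e * (real n)\<^sup>2" by (simp add: e_def sum_nonneg)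
  ultimately show thesis using that by blast
qed

section \<open>Cauchy-Schwarz for semidefinite forms\<close>

text \<open>Discriminant criterion. The degenerate case \<open>d = 0\<close> is included so that it
  applies to semidefinite forms.\<close>

lemma power2_le_mult_if_quadratic_nonneg:
  fixes a b d :: real
  assumes "\<And>t. 0 \<le> a + 2 * t * b + t\<^sup>2 * d"
  shows "b\<^sup>2 \<le> a * d"
proof (cases "d = 0")
  case True
  have "b = 0"
  proof (rule ccontr)
    assume "b \<noteq> 0"
    \<comment> \<open>At this \<open>t\<close> the affine function a + 2 t b takes the value
      -1.\<close>
    thus False using assms[of "- (a + 1) / (2 * b)"] True by (simp add: field_simps)
  qed
  thus ?thesis using True by simp
next
  case False
  have "0 \<le> a * d\<^sup>2 - b\<^sup>2 * d"
  proof -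
    \<comment> \<open>-b/d is the critical point of the quadratic; the factor d^2 clears the
      denominators.\<close>
    have "0 \<le> (a + 2 * (- b / d) * b + (- b / d)\<^sup>2 * d) * d\<^sup>2"
      using assms[of "- b / d"] by simp
    also have "\<dots> = a * d\<^sup>2 - b\<^sup>2 * d" using False by (simp add: field_simps power2_eq_square)
    finally show ?thesis .
  qed
  moreover have "0 \<le> d"
  proof (rule ccontr)
    assume "\<not> 0 \<le> d"
    \<comment> \<open>Adding the values at \<open>t\<close> and \<open>- t\<close> removes the
      linear term, and this \<open>t\<close> is large enough that t^2 (-d) \<ge> t (-d) >
      |a|.\<close>
    define t where "t = \<bar>a\<bar> / - d + 1"
    have t: "1 \<le> t" "t * - d = \<bar>a\<bar> - d"
      using \<open>\<not> 0 \<le> d\<close> by (auto simp: t_def field_simps)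
    have "t * - d \<le> - (t\<^sup>2 * d)"
      using t \<open>\<not> 0 \<le> d\<close> mult_right_mono[of t "t\<^sup>2" "- d"]
      by (simp add: power2_eq_square)
    moreover have "0 \<le> a + t\<^sup>2 * d" using assms[of t] assms[of "- t"] by simp
    ultimately show False using t(2) \<open>\<not> 0 \<le> d\<close> by linarith
  qed
  ultimately have "b\<^sup>2 * d \<le> (a * d) * d" by (simp add: power2_eq_square)
  thus ?thesis using \<open>0 \<le> d\<close> False by simp
qed

text \<open>Along the line x + t y the form is a nonnegative quadratic in t; by symmetry its two
  mixed terms coincide, so the discriminant criterion applies.\<close>

lemma psd_Cauchy_Schwarz:
  fixes B :: "real mat"
  assumes B: "B \<in> carrier_mat n n" and sym: "transpose_mat B = B"
    and psd: "\<And>x. x \<in> carrier_vec n \<Longrightarrow> 0 \<le> x \<bullet> (B *\<^sub>v x)"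
    and x: "x \<in> carrier_vec n" and y: "y \<in> carrier_vec n"
  shows "(x \<bullet> (B *\<^sub>v y))\<^sup>2 \<le> (x \<bullet> (B *\<^sub>v x)) * (y \<bullet> (B *\<^sub>v y))"
proof (rule power2_le_mult_if_quadratic_nonneg)
  fix t :: real
  have comm: "y \<bullet> (B *\<^sub>v x) = x \<bullet> (B *\<^sub>v y)"
    using transpose_vec_mult_scalar[OF B y x] comm_scalar_prod[OF y mult_mat_vec_carrier[OF B x]]
    by (simp add: sym)
  have "(x + t \<cdot>\<^sub>v y) \<bullet> (B *\<^sub>v (x + t \<cdot>\<^sub>v y)) =
      x \<bullet> (B *\<^sub>v x) + t * (x \<bullet> (B *\<^sub>v y)) + (t * (y \<bullet> (B *\<^sub>v x)) + t * t * (y \<bullet> (B *\<^sub>v y)))"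
    using B x y
    by (simp add: mult_add_distrib_mat_vec[of _ n n] mult_mat_vec[of _ n n]
        add_scalar_prod_distrib[of _ n] scalar_prod_add_distrib[of _ n] algebra_simps)
  moreover have "0 \<le> (x + t \<cdot>\<^sub>v y) \<bullet> (B *\<^sub>v (x + t \<cdot>\<^sub>v y))"
    using x y by (intro psd) auto
  ultimately show "0 \<le> x \<bullet> (B *\<^sub>v x) + 2 * t * (x \<bullet> (B *\<^sub>v y)) + t\<^sup>2 * (y \<bullet> (B *\<^sub>v y))"
    by (simp add: comm power2_eq_square)
qed

lemma scalar_prod_Cauchy_Schwarz:
  fixes x y :: "real vec"
  assumes "x \<in> carrier_vec n" "y \<in> carrier_vec n"
  shows "(x \<bullet> y)\<^sup>2 \<le> (x \<bullet> x) * (y \<bullet> y)"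
  using psd_Cauchy_Schwarz[of "1\<^sub>m n" n x y] assms by (simp add: scalar_prod_self_nonneg)

section \<open>Invertibility and coercivity\<close>

text \<open>A trivial kernel makes the determinant nonzero, so \<open>mat_inverse\<close> returns
  \<open>Some\<close> inverse and the \<open>the\<close> in \<open>minv\<close> is well
  defined.\<close>

lemma minv_mult:
  fixes A :: "real mat"
  assumes A: "A \<in> carrier_mat n n"
    and ker: "\<And>v. v \<in> carrier_vec n \<Longrightarrow> A *\<^sub>v v = 0\<^sub>v n \<Longrightarrow> v = 0\<^sub>v n"
  shows "minv A \<in> carrier_mat n n" "minv A * A = 1\<^sub>m n" "A * minv A = 1\<^sub>m n"
proof -
  have "det A \<noteq> 0" using det_0_iff_vec_prod_zero_field[OF A] ker by blast
  hence "A \<in> Units (ring_mat TYPE(real) n ())" by (rule det_non_zero_imp_unit[OF A])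
  then obtain C where "mat_inverse A = Some C" using mat_inverse(1)[OF A] by fastforce
  with mat_inverse(2)[OF A this] show "minv A \<in> carrier_mat n n" "minv A * A = 1\<^sub>m n" "A * minv A = 1\<^sub>m n"
    by (auto simp: minv_def)
qed

text \<open>No compactness is needed: with \<open>y = B x\<close>, Cauchy-Schwarz for the form of \<open>B\<close> gives
  \<open>|B x|\<^sup>4 \<le> (x \<bullet> B x) (B x \<bullet> B (B x))\<close>, and \<open>|B x|\<close> dominates \<open>|x|\<close> because \<open>B\<close> is invertible.\<close>

lemma psd_nonsingular_coercive:
  fixes B :: "real mat"
  assumes B: "B \<in> carrier_mat n n" and sym: "transpose_mat B = B"
    and psd: "\<And>x. x \<in> carrier_vec n \<Longrightarrow> 0 \<le> x \<bullet> (B *\<^sub>v x)"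
    and ker: "\<And>v. v \<in> carrier_vec n \<Longrightarrow> B *\<^sub>v v = 0\<^sub>v n \<Longrightarrow> v = 0\<^sub>v n"
  obtains c where "0 < c" "\<And>x. x \<in> carrier_vec n \<Longrightarrow> c * (x \<bullet> x) \<le> x \<bullet> (B *\<^sub>v x)"
proof -
  note inv = minv_mult[OF B ker]
  obtain C where C: "0 \<le> C" "\<And>x. x \<in> carrier_vec n \<Longrightarrow> (B *\<^sub>v x) \<bullet> (B *\<^sub>v x) \<le> C * (x \<bullet> x)"
    using mult_mat_vec_bounded[OF B] by metis
  obtain D where D: "0 \<le> D"
    "\<And>x. x \<in> carrier_vec n \<Longrightarrow> (minv B *\<^sub>v x) \<bullet> (minv B *\<^sub>v x) \<le> D * (x \<bullet> x)"
    using mult_mat_vec_bounded[OF inv(1)] by metis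
  have main: "x \<bullet> x \<le> D * (C + 1) * (x \<bullet> (B *\<^sub>v x))" if x: "x \<in> carrier_vec n" for x
  proof -
    let ?y = "B *\<^sub>v x"
    have y: "?y \<in> carrier_vec n" using B x by auto
    have "minv B *\<^sub>v ?y = x"
      using inv x B by (subst assoc_mult_mat_vec[symmetric, of _ n n _ n]) auto
    hence xy: "x \<bullet> x \<le> D * (?y \<bullet> ?y)" using D(2)[OF y] by simp
    \<comment> \<open>Cauchy-Schwarz gives (y \<bullet> B y)^2 \<le> C |y|^4. Since C \<le> (C +
      1)^2, the right side is dominated by a perfect square, and roots can be taken without
      \<open>sqrt C\<close>.\<close>
    have yBy: "?y \<bullet> (B *\<^sub>v ?y) \<le> (C + 1) * (?y \<bullet> ?y)"
    proof -
      have "(?y \<bullet> (B *\<^sub>v ?y))\<^sup>2 \<le> (?y \<bullet> ?y) * ((B *\<^sub>v ?y) \<bullet> (B *\<^sub>v ?y))"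
        using y B by (intro scalar_prod_Cauchy_Schwarz) auto
      also have "\<dots> \<le> (?y \<bullet> ?y) * (C * (?y \<bullet> ?y))"
        using C(2)[OF y] by (intro mult_left_mono) (auto simp: scalar_prod_self_nonneg)
      also have "\<dots> \<le> ((C + 1) * (?y \<bullet> ?y))\<^sup>2"
      proof -
        have "C \<le> (C + 1)\<^sup>2" using C(1) by (simp add: power2_eq_square algebra_simps)
        hence "C * (?y \<bullet> ?y)\<^sup>2 \<le> (C + 1)\<^sup>2 * (?y \<bullet> ?y)\<^sup>2" by (intro mult_right_mono) auto
        thus ?thesis by (simp add: power2_eq_square algebra_simps)
      qed
      finally show ?thesis using C(1) by (auto intro: power2_le_imp_le simp: scalar_prod_self_nonneg)
    qed
    have "(?y \<bullet> ?y)\<^sup>2 \<le> (x \<bullet> (B *\<^sub>v x)) * (?y \<bullet> (B *\<^sub>v ?y))"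
    proof -
      \<comment> \<open>Symmetry moves one factor B to the left argument.\<close>
      have "x \<bullet> (B *\<^sub>v ?y) = ?y \<bullet> ?y"
        using transpose_vec_mult_scalar[OF B y x] by (simp add: sym)
      thus ?thesis using psd_Cauchy_Schwarz[OF B sym psd x y] by simp
    qed
    also have "\<dots> \<le> (x \<bullet> (B *\<^sub>v x)) * ((C + 1) * (?y \<bullet> ?y))"
      using yBy psd[OF x] by (intro mult_left_mono) auto
    finally have "(?y \<bullet> ?y) * (?y \<bullet> ?y) \<le> ((C + 1) * (x \<bullet> (B *\<^sub>v x))) * (?y \<bullet> ?y)"
      by (simp add: power2_eq_square mult_ac)
    \<comment> \<open>The common factor |B x|^2 is cancelled; if it vanishes, semidefiniteness
      already gives the claim.\<close>
    hence "?y \<bullet> ?y \<le> (C + 1) * (x \<bullet> (B *\<^sub>v x))"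
      using psd[OF x] C(1) scalar_prod_self_nonneg[of ?y]
      by (cases "?y \<bullet> ?y = 0") auto
    hence "D * (?y \<bullet> ?y) \<le> D * ((C + 1) * (x \<bullet> (B *\<^sub>v x)))" using D(1) by (rule mult_left_mono)
    thus ?thesis using xy by (simp add: mult_ac)
  qed
  \<comment> \<open>The added 1 keeps the denominator positive when \<open>D = 0\<close>.\<close>
  define c where "c = 1 / (D * (C + 1) + 1)"
  have "0 < c" using C(1) D(1) by (simp add: c_def add_nonneg_pos)
  moreover have "c * (x \<bullet> x) \<le> x \<bullet> (B *\<^sub>v x)" if "x \<in> carrier_vec n" for x
  proof -
    have "x \<bullet> x \<le> (D * (C + 1) + 1) * (x \<bullet> (B *\<^sub>v x))"
      using main[OF that] psd[OF that] by (simp add: algebra_simps)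
    moreover have "0 < D * (C + 1) + 1" using C(1) D(1) by (simp add: add_nonneg_pos)
    ultimately show ?thesis by (simp add: c_def field_simps)
  qed
  ultimately show thesis using that by blast
qed

text \<open>Linear independence refers to the set of columns, so repetitions are excluded first: a
  repeated column leaves fewer than n distinct ones, too few for rank n. With distinct columns, a
  nonzero kernel vector is a linear dependence.\<close>

lemma full_column_rank_inj:
  fixes A :: "real mat"
  assumes A: "A \<in> carrier_mat m n" and rank: "vec_space.rank m A = n"
    and v: "v \<in> carrier_vec n" "A *\<^sub>v v = 0\<^sub>v m"
  shows "v = 0\<^sub>v n"
proof -
  interpret vec_space "TYPE(real)" m .
  have "distinct (cols A)"
  proof (rule ccontr)
    assume nd: "\<not> distinct (cols A)"
    \<comment> \<open>The rank is the size of a maximal independent set of columns.\<close>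
    obtain S where S: "maximal S (\<lambda>T. T \<subseteq> set (cols A) \<and> lin_indpt T)"
      using maximal_exists[of "(\<lambda>T. T \<subseteq> set (cols A) \<and> lin_indpt T)" "card (set (cols A))" "{}"]
      by (meson List.finite_set card_mono empty_iff empty_subsetI finite_lin_indpt2 rev_finite_subset)
    hence "card S \<le> card (set (cols A))" by (simp add: card_mono maximal_def)
    also have "\<dots> < n"
      using A nd card_distinct[of "cols A"] card_length[of "cols A"] by (auto simp: le_less)
    finally show False using rank_card_indpt[OF A S] rank by simp
  qed
  thus ?thesis using full_rank_lin_indpt[OF A rank] lin_depI[OF A v(1) _ v(2)] by blast
qed

section \<open>Rayleigh bound by the largest eigenvalue\<close>

text \<open>The least constant \<open>b\<close> in the inequality is an eigenvalue of
  \<open>A' A\<close>: otherwise b I - A' A would be semidefinite and nonsingular, hence coercive,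
  and \<open>b\<close> could be lowered.\<close>

lemma scalar_prod_mult_mat_vec_le_lambda_max:
  fixes A :: "real mat"
  assumes A: "A \<in> carrier_mat m n" and n: "0 < n" and x: "x \<in> carrier_vec n"
  shows "(A *\<^sub>v x) \<bullet> (A *\<^sub>v x) \<le> lambda_max (transpose_mat A * A) * (x \<bullet> x)"
proof -
  let ?S = "transpose_mat A * A"
  define R where "R = {b. \<forall>x\<in>carrier_vec n. (A *\<^sub>v x) \<bullet> (A *\<^sub>v x) \<le> b * (x \<bullet> x)}"
  define b where "b = Inf R"
  have S: "?S \<in> carrier_mat n n" using A by auto
  have pos: "0 < unit_vec n 0 \<bullet> (unit_vec n 0 :: real vec)" using n by simp
  obtain C where "\<And>x. x \<in> carrier_vec n \<Longrightarrow> (A *\<^sub>v x) \<bullet> (A *\<^sub>v x) \<le> C * (x \<bullet> x)"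
    using mult_mat_vec_bounded[OF A] by metis
  hence "C \<in> R" by (simp add: R_def)
  hence R0: "R \<noteq> {}" by blast
  \<comment> \<open>Testing on a unit vector, available because \<open>0 < n\<close>, shows that
    \<open>R\<close> is bounded below, so its infimum is meaningful.\<close>
  have Rpos: "0 \<le> c" if "c \<in> R" for c
  proof -
    have "0 \<le> c * (unit_vec n 0 \<bullet> (unit_vec n 0 :: real vec))"
      using that scalar_prod_self_nonneg[of "A *\<^sub>v unit_vec n 0"] unfolding R_def
      by (auto intro: order_trans)
    thus ?thesis using pos by (simp add: zero_le_mult_iff)
  qed
  hence bdd: "bdd_below R" by (auto simp: bdd_below_def)
  \<comment> \<open>The infimum belongs to \<open>R\<close>: for nonzero x every member of
    \<open>R\<close> is at least the Rayleigh quotient of x, hence so is \<open>b\<close>.\<close>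
  have bR: "b \<in> R"
    unfolding R_def
  proof (intro CollectI ballI)
    fix x :: "real vec" assume x: "x \<in> carrier_vec n"
    show "(A *\<^sub>v x) \<bullet> (A *\<^sub>v x) \<le> b * (x \<bullet> x)"
    proof (cases "x = 0\<^sub>v n")
      case True
      have "(A *\<^sub>v x) \<bullet> (A *\<^sub>v x) \<le> C * (x \<bullet> x)" using \<open>C \<in> R\<close> x by (simp add: R_def)
      thus ?thesis by (simp add: True)
    next
      case False
      hence xx: "0 < x \<bullet> x" using scalar_prod_self_pos[OF x] by simp
      have "(A *\<^sub>v x) \<bullet> (A *\<^sub>v x) / (x \<bullet> x) \<le> b"
        unfolding b_def using R0 x xx by (intro cInf_greatest) (auto simp: R_def field_simps)
      thus ?thesis using xx by (simp add: field_simps)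
    qed
  qed
  have "eigenvalue ?S b"
  proof (rule ccontr)
    assume ne: "\<not> eigenvalue ?S b"
    define B where "B = b \<cdot>\<^sub>m 1\<^sub>m n - ?S"
    have Bv: "B *\<^sub>v v = b \<cdot>\<^sub>v v - ?S *\<^sub>v v" if "v \<in> carrier_vec n" for v
      using that S unfolding B_def
      by (subst minus_mult_distrib_mat_vec[of _ n n]) (auto simp: smult_mult_mat_vec[of _ n n])
    have Bform: "v \<bullet> (B *\<^sub>v v) = b * (v \<bullet> v) - (A *\<^sub>v v) \<bullet> (A *\<^sub>v v)" if v: "v \<in> carrier_vec n" for v
      using v S A scalar_prod_transpose_mult_mat_vec[OF A v v]
      by (simp add: Bv scalar_prod_minus_distrib[of _ n])
    have B: "B \<in> carrier_mat n n" using S by (simp add: B_def minus_carrier_mat)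
    have Ssym: "?S $$ (i,j) = ?S $$ (j,i)" if "i < n" "j < n" for i j
      using that A by (simp add: comm_scalar_prod[of _ m])
    have sym: "transpose_mat B = B"
      using S Ssym by (intro eq_matI) (auto simp: B_def simp del: index_mult_mat)
    have psd: "0 \<le> v \<bullet> (B *\<^sub>v v)" if "v \<in> carrier_vec n" for v
      using bR that unfolding R_def by (simp add: Bform)
    \<comment> \<open>A nonzero kernel vector of \<open>B\<close> would be an eigenvector of
      \<open>A' A\<close> for \<open>b\<close>.\<close>
    have ker: "v = 0\<^sub>v n" if v: "v \<in> carrier_vec n" and "B *\<^sub>v v = 0\<^sub>v n" for v
    proof (rule ccontr)
      assume "v \<noteq> 0\<^sub>v n"
      moreover have "?S *\<^sub>v v = b \<cdot>\<^sub>v v"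
      proof (rule eq_vecI)
        fix i assume "i < dim_vec (b \<cdot>\<^sub>v v)"
        hence "i < n" using v by auto
        thus "(?S *\<^sub>v v) $ i = (b \<cdot>\<^sub>v v) $ i"
          using arg_cong[OF \<open>B *\<^sub>v v = 0\<^sub>v n\<close>[unfolded Bv[OF v]], of "\<lambda>w. w $ i"] v S A
          by (auto simp del: index_mult_mat_vec)
      qed (use v A in auto)
      ultimately show False using ne v A by (auto simp: eigenvalue_def eigenvector_def)
    qed
    obtain c where c: "0 < c" "\<And>x. x \<in> carrier_vec n \<Longrightarrow> c * (x \<bullet> x) \<le> x \<bullet> (B *\<^sub>v x)"
      using psd_nonsingular_coercive[OF B sym psd ker] by metis
    have "b - c \<in> R" using c(2) Bform unfolding R_def by (auto simp: algebra_simps)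
    hence "b \<le> b - c" unfolding b_def by (intro cInf_lower bdd)
    thus False using c(1) by simp
  qed
  \<comment> \<open>\<open>Max\<close> is meaningful only on a finite set; the eigenvalues are roots
    of the nonzero characteristic polynomial.\<close>
  moreover have "finite {e. eigenvalue ?S e}"
  proof -
    have "char_poly ?S \<noteq> 0" using degree_monic_char_poly[OF S] by auto
    thus ?thesis using poly_roots_finite by (simp add: eigenvalue_root_char_poly[OF S])
  qed
  ultimately have "b \<le> lambda_max ?S" unfolding lambda_max_def by (intro Max_ge) auto
  hence "b * (x \<bullet> x) \<le> lambda_max ?S * (x \<bullet> x)"
    by (intro mult_right_mono scalar_prod_self_nonneg)
  moreover have "(A *\<^sub>v x) \<bullet> (A *\<^sub>v x) \<le> b * (x \<bullet> x)" using bR x unfolding R_def by auto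
  ultimately show ?thesis by linarith
qed

section \<open>Second moments of Gaussian linear forms\<close>

text \<open>Independence: the integrand is a product of powers of single centred coordinates, so its
  integral over the product measure factors into one-dimensional Gaussian moments.\<close>

lemma normal_product_covariance:
  fixes \<mu> :: "'i \<Rightarrow> real"
  assumes I: "finite I" and \<sigma>: "0 < \<sigma>" and ij: "i \<in> I" "j \<in> I"
  defines "M \<equiv> PiM I (\<lambda>i. density lborel (normal_density (\<mu> i) \<sigma>))"
  shows "has_bochner_integral M (\<lambda>Y. (Y i - \<mu> i) * (Y j - \<mu> j)) (if i = j then \<sigma>\<^sup>2 else 0)"
proof -
  let ?N = "\<lambda>i. density lborel (normal_density (\<mu> i) \<sigma>)"
  interpret product_sigma_finite ?N
    unfolding product_sigma_finite_def
    using prob_space_normal_density[OF \<sigma>] prob_space_imp_sigma_finite by blast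
  \<comment> \<open>The exponent counts how often coordinate \<open>l\<close> occurs, which treats
    \<open>i = j\<close> and \<open>i \<noteq> j\<close> together.\<close>
  define e where "e l = (of_bool (l = i) + of_bool (l = j) :: nat)" for l
  have int: "integrable (?N l) (\<lambda>y. (y - \<mu> l) ^ m)" for l m
    using integrable_normal_moment[OF \<sigma>, of "\<mu> l" m] by (subst integrable_density) auto
  have expct: "integral\<^sup>L (?N l) (\<lambda>y. (y - \<mu> l) ^ m) = integral\<^sup>L lborel (\<lambda>y. normal_density (\<mu> l) \<sigma> y * (y - \<mu> l) ^ m)"
    for l m by (subst integral_density) auto
  have moments: "integral\<^sup>L (?N l) (\<lambda>y. (y - \<mu> l) ^ m) = (if m = 0 then 1 else if m = 1 then 0 else \<sigma>\<^sup>2)"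
    if "m \<le> 2" for l m
  proof -
    consider "m = 0" | "m = 1" | "m = 2" using \<open>m \<le> 2\<close> by linarith
    thus ?thesis
      unfolding expct
      using integral_normal_moment_even[OF \<sigma>, of "\<mu> l" 1] integral_normal_moment_odd[OF \<sigma>, of "\<mu> l" 0]
      by cases (simp_all add: fact_numeral \<sigma>)
  qed
  have fact: "(\<Prod>l\<in>I. (Y l - \<mu> l) ^ e l) = (Y i - \<mu> i) * (Y j - \<mu> j)" for Y
  proof -
    have "(\<Prod>l\<in>I. (Y l - \<mu> l) ^ e l) =
        (\<Prod>l\<in>I. (if l = i then Y l - \<mu> l else 1)) * (\<Prod>l\<in>I. (if l = j then Y l - \<mu> l else 1))"
      unfolding prod.distrib[symmetric] by (intro prod.cong) (auto simp: e_def)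
    thus ?thesis using I ij by simp
  qed
  have "integrable M (\<lambda>Y. \<Prod>l\<in>I. (Y l - \<mu> l) ^ e l)"
    unfolding M_def using product_integrable_prod[OF I int] by simp
  moreover have "integral\<^sup>L M (\<lambda>Y. \<Prod>l\<in>I. (Y l - \<mu> l) ^ e l) = (if i = j then \<sigma>\<^sup>2 else 0)"
  proof -
    have "integral\<^sup>L M (\<lambda>Y. \<Prod>l\<in>I. (Y l - \<mu> l) ^ e l) =
        (\<Prod>l\<in>I. integral\<^sup>L (?N l) (\<lambda>y. (y - \<mu> l) ^ e l))"
      unfolding M_def using product_integral_prod[OF I int] by simp
    also have "\<dots> = (\<Prod>l\<in>I. if e l = 0 then 1 else if e l = 1 then 0 else \<sigma>\<^sup>2)"
      by (intro prod.cong refl moments) (auto simp: e_def)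
    also have "\<dots> = (if i = j then \<sigma>\<^sup>2 else 0)"
    proof (cases "i = j")
      case True
      have "(\<Prod>l\<in>I. if e l = 0 then 1 else if e l = 1 then 0 else \<sigma>\<^sup>2) = (\<Prod>l\<in>I. if l = i then \<sigma>\<^sup>2 else 1)"
        by (intro prod.cong) (auto simp: e_def True)
      thus ?thesis using True I ij by simp
    next
      case False
      \<comment> \<open>Coordinate \<open>i\<close> has exponent 1, so its factor is a vanishing
        first moment.\<close>
      thus ?thesis using I ij by (auto simp: e_def intro!: prod_zero)
    qed
    finally show ?thesis .
  qed
  ultimately show ?thesis unfolding fact by (simp add: has_bochner_integral_iff)
qed

text \<open>Expanding the square gives a double sum of covariances, of which only the diagonal
  survives.\<close>

lemma normal_product_linear_form_second_moment:
  fixes \<mu> a :: "'i \<Rightarrow> real"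
  assumes I: "finite I" and \<sigma>: "0 < \<sigma>"
  defines "M \<equiv> PiM I (\<lambda>i. density lborel (normal_density (\<mu> i) \<sigma>))"
  shows "has_bochner_integral M (\<lambda>Y. (\<Sum>i\<in>I. a i * (Y i - \<mu> i))\<^sup>2) (\<sigma>\<^sup>2 * (\<Sum>i\<in>I. (a i)\<^sup>2))"
proof -
  have "has_bochner_integral M (\<lambda>Y. \<Sum>i\<in>I. \<Sum>j\<in>I. (a i * a j) * ((Y i - \<mu> i) * (Y j - \<mu> j)))
      (\<Sum>i\<in>I. \<Sum>j\<in>I. (a i * a j) * (if i = j then \<sigma>\<^sup>2 else 0))"
    unfolding M_def using I \<sigma>
    by (intro has_bochner_integral_sum has_bochner_integral_mult_right normal_product_covariance)
  moreover have "(\<Sum>i\<in>I. \<Sum>j\<in>I. (a i * a j) * (if i = j then \<sigma>\<^sup>2 else 0)) = \<sigma>\<^sup>2 * (\<Sum>i\<in>I. (a i)\<^sup>2)"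
    using I by (simp add: if_distrib sum_distrib_left power2_eq_square mult_ac cong: if_cong)
  moreover have "(\<Sum>i\<in>I. \<Sum>j\<in>I. (a i * a j) * ((Y i - \<mu> i) * (Y j - \<mu> j))) = (\<Sum>i\<in>I. a i * (Y i - \<mu> i))\<^sup>2" for Y
    by (simp add: power2_eq_square sum_product mult_ac)
  ultimately show ?thesis by simp
qed

section \<open>Probabilities under the sampling distribution\<close>

lemma prob_space_Pdist:
  assumes "0 < \<sigma>"
  shows "prob_space (Pdist n X \<beta> \<sigma>)"
  unfolding Pdist_def using assms by (intro prob_space_PiM prob_space_normal_density)

lemma PrY_nonneg: "0 \<le> PrY n X \<beta> \<sigma> E"
  by (simp add: PrY_def)

lemma PrY_le_1:
  assumes "0 < \<sigma>"
  shows "PrY n X \<beta> \<sigma> E \<le> 1"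
proof -
  interpret prob_space "Pdist n X \<beta> \<sigma>" using assms by (rule prob_space_Pdist)
  show ?thesis by (simp add: PrY_def)
qed

text \<open>A non-measurable event has \<open>measure\<close> 0, so the bound holds for every predicate \<open>E\<close>.\<close>

lemma PrY_score_Markov:
  assumes \<sigma>: "0 < \<sigma>" and X: "X \<in> carrier_mat n k" and b: "\<beta> \<in> carrier_vec k" and t: "0 < t"
    and E: "\<And>Y. Y \<in> carrier_vec n \<Longrightarrow> E Y \<Longrightarrow>
      t \<le> (transpose_mat X *\<^sub>v (Y - X *\<^sub>v \<beta>)) \<bullet> (transpose_mat X *\<^sub>v (Y - X *\<^sub>v \<beta>))"
  shows "PrY n X \<beta> \<sigma> E \<le> \<sigma>\<^sup>2 * (\<Sum>j<k. (transpose_mat X * X) $$ (j,j)) / t"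
proof -
  let ?M = "Pdist n X \<beta> \<sigma>"
  interpret prob_space ?M using \<sigma> by (rule prob_space_Pdist)
  \<comment> \<open>This is |X' u|^2 as a function on the sample space, written in coordinates so
    that each summand is a squared centred linear form.\<close>
  define f where "f Y = (\<Sum>j<k. (\<Sum>i<n. X $$ (i,j) * (Y i - (X *\<^sub>v \<beta>) $ i))\<^sup>2)" for Y
  have f: "has_bochner_integral ?M f (\<Sum>j<k. \<sigma>\<^sup>2 * (\<Sum>i<n. (X $$ (i,j))\<^sup>2))"
    unfolding f_def Pdist_def using \<sigma>
    by (intro has_bochner_integral_sum normal_product_linear_form_second_moment) auto
  \<comment> \<open>The sum of the squared entries of \<open>X\<close> is the trace of
    \<open>X' X\<close>, so \<beta> has dropped out.\<close>
  have tr: "(\<Sum>j<k. \<sigma>\<^sup>2 * (\<Sum>i<n. (X $$ (i,j))\<^sup>2)) = \<sigma>\<^sup>2 * (\<Sum>j<k. (transpose_mat X * X) $$ (j,j))"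
    using X by (auto simp: sum_distrib_left scalar_prod_def power2_eq_square lessThan_atLeast0 intro!: sum.cong)
  have feq: "f Y = (transpose_mat X *\<^sub>v (vec n Y - X *\<^sub>v \<beta>)) \<bullet> (transpose_mat X *\<^sub>v (vec n Y - X *\<^sub>v \<beta>))" for Y
    using X by (auto simp: f_def scalar_prod_def power2_eq_square lessThan_atLeast0 intro!: sum.cong)
  have fm: "f \<in> borel_measurable ?M" using f by (auto simp: has_bochner_integral_iff)
  have nonneg: "0 \<le> f Y" for Y by (simp add: f_def sum_nonneg)
  have "PrY n X \<beta> \<sigma> E \<le> measure ?M {Y \<in> space ?M. t \<le> f Y}"
    unfolding PrY_def
  proof (rule finite_measure_mono)
    show "{Y \<in> space ?M. E (vec n Y)} \<subseteq> {Y \<in> space ?M. t \<le> f Y}" using E by (auto simp: feq)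
    show "{Y \<in> space ?M. t \<le> f Y} \<in> sets ?M" using fm by measurable
  qed
  also have "\<dots> \<le> integral\<^sup>L ?M f / t"
    using f t by (intro integral_Markov_inequality_measure[where A = "{}"]) (auto simp: has_bochner_integral_iff nonneg)
  also have "integral\<^sup>L ?M f = \<sigma>\<^sup>2 * (\<Sum>j<k. (transpose_mat X * X) $$ (j,j))"
    using f tr by (simp add: has_bochner_integral_iff)
  finally show ?thesis .
qed

section \<open>The averaged estimator\<close>

text \<open>For large n, X' X / n is so close to Q that half of the coercivity constant of Q
  survives. Each of the finitely many remaining n has a constant of its own by full column rank, and
  the minimum serves for all.\<close>

lemma Gram_coercive_uniformly:
  fixes X :: "nat \<Rightarrow> real mat"
  assumes k: "0 < k" and X: "\<And>n. k \<le> n \<Longrightarrow> X n \<in> carrier_mat n k"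
    and rank: "\<And>n. k \<le> n \<Longrightarrow> vec_space.rank n (X n) = k"
    and lim: "\<And>i j. i < k \<Longrightarrow> j < k \<Longrightarrow>
      (\<lambda>n. (transpose_mat (X n) * X n) $$ (i,j) / real n) \<longlonglongrightarrow> Q $$ (i,j)"
    and Q: "pos_def_mat k Q"
  obtains c where "0 < c"
    "\<And>n v. k \<le> n \<Longrightarrow> v \<in> carrier_vec k \<Longrightarrow> c * real n * (v \<bullet> v) \<le> (X n *\<^sub>v v) \<bullet> (X n *\<^sub>v v)"
proof -
  let ?G = "\<lambda>n. transpose_mat (X n) * X n"
  have Qc: "Q \<in> carrier_mat k k" "transpose_mat Q = Q" using Q by (auto simp: pos_def_mat_def)
  have Qpos: "0 < v \<bullet> (Q *\<^sub>v v)" if "v \<in> carrier_vec k" "v \<noteq> 0\<^sub>v k" for v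
    using Q that by (auto simp: pos_def_mat_def)
  have Qnonneg: "0 \<le> v \<bullet> (Q *\<^sub>v v)" if v: "v \<in> carrier_vec k" for v
    using Qpos[OF v] Qc v by (cases "v = 0\<^sub>v k") auto
  have Qker: "v = 0\<^sub>v k" if v: "v \<in> carrier_vec k" and "Q *\<^sub>v v = 0\<^sub>v k" for v
    using Qpos[OF v] that by fastforce
  obtain c0 where c0: "0 < c0" "\<And>v. v \<in> carrier_vec k \<Longrightarrow> c0 * (v \<bullet> v) \<le> v \<bullet> (Q *\<^sub>v v)"
    using psd_nonsingular_coercive[OF Qc Qnonneg Qker] by metis
  \<comment> \<open>Chosen so that \<open>e * (real k)\<^sup>2 = c0 / 2\<close>, the loss allowed in
    the form.\<close>
  define e where "e = c0 / (2 * (real k)\<^sup>2)"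
  have e: "0 < e" using c0 k by (simp add: e_def)
  have "\<forall>\<^sub>F n in sequentially. \<forall>i<k. \<forall>j<k. dist (?G n $$ (i,j) / real n) (Q $$ (i,j)) < e"
    using lim e by (auto intro!: eventually_all_finite simp: eventually_ball_finite_distrib tendsto_iff
        simp flip: lessThan_iff Ball_def)
  then obtain N where N: "\<And>n i j. N \<le> n \<Longrightarrow> i < k \<Longrightarrow> j < k \<Longrightarrow> dist (?G n $$ (i,j) / real n) (Q $$ (i,j)) < e"
    unfolding eventually_sequentially by blast
  have large: "c0 / 2 * real n * (v \<bullet> v) \<le> (X n *\<^sub>v v) \<bullet> (X n *\<^sub>v v)"
    if n: "N \<le> n" "k \<le> n" and v: "v \<in> carrier_vec k" for n v
  proof -
    define S where "S = (1 / real n) \<cdot>\<^sub>m ?G n - Q"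
    have n0: "0 < n" using n k by simp
    have G: "?G n \<in> carrier_mat k k" using X[OF n(2)] by auto
    have S: "S \<in> carrier_mat k k" using Qc G by (simp add: S_def minus_carrier_mat)
    have "\<bar>S $$ (i,j)\<bar> \<le> e" if "i < k" "j < k" for i j
      using N[OF n(1) that] that G Qc by (simp add: S_def dist_real_def del: index_mult_mat)
    hence "\<bar>v \<bullet> (S *\<^sub>v v)\<bar> \<le> e * (real k)\<^sup>2 * (v \<bullet> v)"
      using abs_quadratic_form_le[OF S v] by blast
    hence "\<bar>v \<bullet> (S *\<^sub>v v)\<bar> \<le> c0 / 2 * (v \<bullet> v)" using k by (simp add: e_def)
    moreover have "v \<bullet> (S *\<^sub>v v) = (X n *\<^sub>v v) \<bullet> (X n *\<^sub>v v) / real n - v \<bullet> (Q *\<^sub>v v)"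
    proof -
      have "S *\<^sub>v v = (1 / real n) \<cdot>\<^sub>v (?G n *\<^sub>v v) - Q *\<^sub>v v"
        unfolding S_def using G Qc v
        by (subst minus_mult_distrib_mat_vec[of _ k k]) (auto simp: smult_mult_mat_vec[of _ k k])
      thus ?thesis
        using G Qc v scalar_prod_transpose_mult_mat_vec[OF X[OF n(2)] v v]
        by (simp add: scalar_prod_minus_distrib[of _ k])
    qed
    ultimately have "c0 / 2 * (v \<bullet> v) \<le> (X n *\<^sub>v v) \<bullet> (X n *\<^sub>v v) / real n"
      using c0(2)[OF v] by linarith
    thus ?thesis using n0 by (simp add: field_simps)
  qed
  have each: "\<exists>d>0. \<forall>v\<in>carrier_vec k. d * real n * (v \<bullet> v) \<le> (X n *\<^sub>v v) \<bullet> (X n *\<^sub>v v)"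
    if n: "k \<le> n" for n
  proof -
    note X = X[OF n]
    have G: "?G n \<in> carrier_mat k k" using X by auto
    have sym: "transpose_mat (?G n) = ?G n"
      using X by (intro eq_matI) (auto simp: comm_scalar_prod[of _ n])
    have nonneg: "0 \<le> v \<bullet> (?G n *\<^sub>v v)" if "v \<in> carrier_vec k" for v
      by (simp add: scalar_prod_transpose_mult_mat_vec[OF X that that] scalar_prod_self_nonneg)
    have ker: "v = 0\<^sub>v k" if v: "v \<in> carrier_vec k" and "?G n *\<^sub>v v = 0\<^sub>v k" for v
    proof (rule full_column_rank_inj[OF X rank[OF n] v], rule ccontr)
      assume "X n *\<^sub>v v \<noteq> 0\<^sub>v n"
      hence "0 < (X n *\<^sub>v v) \<bullet> (X n *\<^sub>v v)" using X v by (intro scalar_prod_self_pos) auto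
      thus False using scalar_prod_transpose_mult_mat_vec[OF X v v] that by simp
    qed
    obtain d where d: "0 < d" "\<And>v. v \<in> carrier_vec k \<Longrightarrow> d * (v \<bullet> v) \<le> v \<bullet> (?G n *\<^sub>v v)"
      using psd_nonsingular_coercive[OF G sym nonneg ker] by metis
    \<comment> \<open>Dividing by n converts the constant of the unscaled Gram matrix to the scaling
      \<open>c * real n\<close>.\<close>
    show ?thesis
      using d n k scalar_prod_transpose_mult_mat_vec[OF X] by (intro exI[of _ "d / real n"]) auto
  qed
  then obtain d where d: "\<And>n. k \<le> n \<Longrightarrow> 0 < d n"
    "\<And>n v. k \<le> n \<Longrightarrow> v \<in> carrier_vec k \<Longrightarrow> d n * real n * (v \<bullet> v) \<le> (X n *\<^sub>v v) \<bullet> (X n *\<^sub>v v)"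
    by metis
  \<comment> \<open>Inserting \<open>c0 / 2\<close> keeps the set nonempty even if no n lies between
    \<open>k\<close> and \<open>N\<close>.\<close>
  define c where "c = Min (insert (c0 / 2) (d ` {k..<N}))"
  have "0 < c" using c0 d by (simp add: c_def)
  moreover have "c * real n * (v \<bullet> v) \<le> (X n *\<^sub>v v) \<bullet> (X n *\<^sub>v v)"
    if n: "k \<le> n" and v: "v \<in> carrier_vec k" for n v
  proof -
    define b where "b = (if N \<le> n then c0 / 2 else d n)"
    have "c \<le> b" unfolding c_def b_def using n by (intro Min_le) auto
    hence "c * (real n * (v \<bullet> v)) \<le> b * (real n * (v \<bullet> v))"
      by (intro mult_right_mono mult_nonneg_nonneg scalar_prod_self_nonneg) auto
    also have "\<dots> \<le> (X n *\<^sub>v v) \<bullet> (X n *\<^sub>v v)"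
      using large[OF _ n v] d(2)[OF n v] by (auto simp: b_def mult_ac)
    finally show ?thesis by (simp add: mult_ac)
  qed
  ultimately show thesis using that by blast
qed

text \<open>The weight is 1 / D with D growing like exp a, where a is proportional to s^2. From a
  \<le> exp a \<le> exp (2 \<alpha> m) D the quotient s^2 / D is bounded, and w^2 \<le> 1 / D
  because D \<ge> 1.\<close>

lemma logistic_weight_bound:
  fixes \<alpha> \<sigma> m s :: real
  assumes "0 < \<alpha>" "0 < \<sigma>"
  defines "w \<equiv> inverse (1 + exp (- 2 * \<alpha> * m) * exp (\<alpha> * s\<^sup>2 / \<sigma>\<^sup>2))"
  shows "w\<^sup>2 * s\<^sup>2 \<le> exp (2 * \<alpha> * m) * \<sigma>\<^sup>2 / \<alpha>"
proof -
  define a where "a = \<alpha> * s\<^sup>2 / \<sigma>\<^sup>2"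
  define D where "D = 1 + exp (- 2 * \<alpha> * m) * exp a"
  have D: "1 \<le> D" by (simp add: D_def)
  have "a \<le> exp a" using exp_ge_add_one_self[of a] by linarith
  hence "a \<le> exp (2 * \<alpha> * m) * D"
    by (simp add: D_def distrib_left mult.assoc[symmetric] flip: exp_add) (simp add: exp_ge_zero add_increasing)
  hence "s\<^sup>2 \<le> exp (2 * \<alpha> * m) * \<sigma>\<^sup>2 / \<alpha> * D"
    using assms(1,2) by (simp add: a_def field_simps)
  hence "s\<^sup>2 / D \<le> exp (2 * \<alpha> * m) * \<sigma>\<^sup>2 / \<alpha>" using D by (simp add: divide_le_eq)
  moreover have "w\<^sup>2 * s\<^sup>2 \<le> s\<^sup>2 / D"
  proof -
    have "1 / D\<^sup>2 * s\<^sup>2 \<le> 1 / D * s\<^sup>2"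
      using D by (intro mult_right_mono divide_left_mono) (auto simp: power2_eq_square)
    thus ?thesis by (simp add: w_def D_def a_def inverse_eq_divide power_divide)
  qed
  ultimately show ?thesis by linarith
qed

lemma scalar_prod_add_self_le:
  fixes x y :: "real vec"
  assumes "x \<in> carrier_vec n" "y \<in> carrier_vec n"
  shows "(x + y) \<bullet> (x + y) \<le> 2 * (x \<bullet> x) + 2 * (y \<bullet> y)"
proof -
  have "(x + y) \<bullet> (x + y) = (\<Sum>i<n. (x $ i + y $ i)\<^sup>2)"
    using assms by (auto simp: scalar_prod_def power2_eq_square lessThan_atLeast0 intro!: sum.cong)
  also have "\<dots> \<le> (\<Sum>i<n. 2 * (x $ i)\<^sup>2 + 2 * (y $ i)\<^sup>2)"
  proof (rule sum_mono)
    fix i show "(x $ i + y $ i)\<^sup>2 \<le> 2 * (x $ i)\<^sup>2 + 2 * (y $ i)\<^sup>2"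
      using sum_squares_bound[of "x $ i" "y $ i"] by (simp add: power2_sum)
  qed
  also have "\<dots> = 2 * (x \<bullet> x) + 2 * (y \<bullet> y)"
    using assms by (simp add: scalar_prod_def power2_eq_square lessThan_atLeast0 sum.distrib sum_distrib_left)
  finally show ?thesis .
qed

section \<open>Deterministic error bounds for one design and one sample\<close>

context
  fixes X :: "real mat" and n k k1 :: nat and c :: real and Y :: "real vec"
  assumes X: "X \<in> carrier_mat n k" and c: "0 < c" and Y: "Y \<in> carrier_vec n"
    and coercive: "\<And>v. v \<in> carrier_vec k \<Longrightarrow> c * (v \<bullet> v) \<le> (X *\<^sub>v v) \<bullet> (X *\<^sub>v v)"
begin

text \<open>Coercivity makes \<open>X' X\<close> injective, so \<open>minv\<close> is its true
  inverse here.\<close>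

lemma betaU_carrier: "betaU X Y \<in> carrier_vec k"
  and normal_equations: "(transpose_mat X * X) *\<^sub>v betaU X Y = transpose_mat X *\<^sub>v Y"
proof -
  let ?G = "transpose_mat X * X"
  have G: "?G \<in> carrier_mat k k" using X by auto
  have "v = 0\<^sub>v k" if v: "v \<in> carrier_vec k" and "?G *\<^sub>v v = 0\<^sub>v k" for v
  proof (rule ccontr)
    assume "v \<noteq> 0\<^sub>v k"
    hence "0 < c * (v \<bullet> v)" using c scalar_prod_self_pos[OF v] by simp
    thus False using coercive[OF v] scalar_prod_transpose_mult_mat_vec[OF X v v] that by simp
  qed
  note inv = minv_mult[OF G this]
  have Z: "transpose_mat X *\<^sub>v Y \<in> carrier_vec k"
    using X Y by (intro mult_mat_vec_carrier[of _ k n]) auto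
  show "betaU X Y \<in> carrier_vec k" unfolding betaU_def using inv(1) Z by auto
  show "?G *\<^sub>v betaU X Y = transpose_mat X *\<^sub>v Y"
    unfolding betaU_def using inv G Z
    by (subst assoc_mult_mat_vec[symmetric, of _ k k _ k]) auto
qed

text \<open>By the normal equations the error w satisfies X' X w = z, so c |w|^2 \<le> w \<bullet> z
  \<le> |w| |z|.\<close>

lemma betaU_error_bound:
  assumes b: "\<beta> \<in> carrier_vec k"
  defines "z \<equiv> transpose_mat X *\<^sub>v (Y - X *\<^sub>v \<beta>)"
  shows "(betaU X Y - \<beta>) \<bullet> (betaU X Y - \<beta>) \<le> (z \<bullet> z) / c\<^sup>2"
proof -
  let ?G = "transpose_mat X * X"
  define w where "w = betaU X Y - \<beta>"
  have w: "w \<in> carrier_vec k" using X b betaU_carrier by (auto simp: w_def)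
  have z: "z \<in> carrier_vec k"
    using X Y b unfolding z_def by (intro mult_mat_vec_carrier[of _ k n]) auto
  have "?G *\<^sub>v w = z"
    unfolding w_def z_def using X Y b betaU_carrier normal_equations
    by (simp add: mult_minus_distrib_mat_vec[of _ k k] mult_minus_distrib_mat_vec[of _ k n])
  hence "c * (w \<bullet> w) \<le> w \<bullet> z"
    using coercive[OF w] scalar_prod_transpose_mult_mat_vec[OF X w w] by simp
  hence "(c * (w \<bullet> w))\<^sup>2 \<le> (w \<bullet> z)\<^sup>2"
    using c by (intro power_mono) (auto simp: scalar_prod_self_nonneg)
  also have "\<dots> \<le> (w \<bullet> w) * (z \<bullet> z)" by (rule scalar_prod_Cauchy_Schwarz[OF w z])
  finally have "(w \<bullet> w) * (c\<^sup>2 * (w \<bullet> w)) \<le> (w \<bullet> w) * (z \<bullet> z)"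
    by (simp add: power2_eq_square mult_ac)
  hence "c\<^sup>2 * (w \<bullet> w) \<le> z \<bullet> z"
    using scalar_prod_self_nonneg[of w] scalar_prod_self_nonneg[of z]
    by (cases "w \<bullet> w = 0") auto
  thus ?thesis using c by (simp add: w_def field_simps)
qed

text \<open>The restricted estimator may be arbitrarily far off, but it enters only through
  \<lambda> d, and coercivity passes from |d| to |X d|, which the weight controls.\<close>

lemma betaT_error_bound:
  assumes \<alpha>: "0 < \<alpha>" and \<sigma>: "0 < \<sigma>" and b: "\<beta> \<in> carrier_vec k"
  defines "z \<equiv> transpose_mat X *\<^sub>v (Y - X *\<^sub>v \<beta>)"
  shows "(vnorm (betaT \<alpha> \<sigma> k1 X Y - \<beta>))\<^sup>2
    \<le> 2 * (exp (2 * \<alpha> * real (k - k1)) * \<sigma>\<^sup>2 / \<alpha>) / c + 2 * (z \<bullet> z) / c\<^sup>2"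
proof -
  define w where "w = betaU X Y - \<beta>"
  define d where "d = betaR k1 X Y - betaU X Y"
  define l where "l = lamhat \<alpha> \<sigma> k1 X Y"
  have R: "betaR k1 X Y \<in> carrier_vec k" using X by (auto simp: betaR_def Let_def)
  note U = betaU_carrier
  have w: "w \<in> carrier_vec k" and d: "d \<in> carrier_vec k" using R U b by (auto simp: w_def d_def)
  have "betaT \<alpha> \<sigma> k1 X Y - \<beta> = w + l \<cdot>\<^sub>v d"
    using R U b by (intro eq_vecI) (auto simp: betaT_def w_def d_def l_def[symmetric] algebra_simps)
  hence "(vnorm (betaT \<alpha> \<sigma> k1 X Y - \<beta>))\<^sup>2 \<le> 2 * (w \<bullet> w) + 2 * ((l \<cdot>\<^sub>v d) \<bullet> (l \<cdot>\<^sub>v d))"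
    using scalar_prod_add_self_le[of w k "l \<cdot>\<^sub>v d"] w d by (simp add: vnorm_power2)
  moreover have "(l \<cdot>\<^sub>v d) \<bullet> (l \<cdot>\<^sub>v d) \<le> exp (2 * \<alpha> * real (k - k1)) * \<sigma>\<^sup>2 / \<alpha> / c"
  proof -
    have Xd: "X *\<^sub>v betaR k1 X Y - X *\<^sub>v betaU X Y = X *\<^sub>v d"
      using X R U by (simp add: d_def mult_minus_distrib_mat_vec[of _ n k])
    have "(l \<cdot>\<^sub>v d) \<bullet> (l \<cdot>\<^sub>v d) * c = l\<^sup>2 * (c * (d \<bullet> d))"
      using d by (simp add: power2_eq_square mult_ac)
    also have "\<dots> \<le> l\<^sup>2 * ((X *\<^sub>v d) \<bullet> (X *\<^sub>v d))"
      by (intro mult_left_mono coercive d) auto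
    also have "\<dots> = l\<^sup>2 * (vnorm (X *\<^sub>v betaR k1 X Y - X *\<^sub>v betaU X Y))\<^sup>2"
      by (simp add: Xd vnorm_power2)
    also have "\<dots> \<le> exp (2 * \<alpha> * real (k - k1)) * \<sigma>\<^sup>2 / \<alpha>"
      using logistic_weight_bound[OF \<alpha> \<sigma>, of "real (k - k1)"] X
      by (simp add: l_def lamhat_def)
    finally show ?thesis by (simp only: pos_le_divide_eq[OF c])
  qed
  ultimately show ?thesis using betaU_error_bound[OF b] by (simp add: w_def z_def)
qed

end

section \<open>Uniform tightness and vanishing tails\<close>

text \<open>Tightness is stated for every predicate \<open>E\<close> that forces a large scaled
  error, so that events about other quantities can be compared directly, with no measurability to
  check.\<close>

lemma betaT_uniformly_tight:
  fixes X :: "nat \<Rightarrow> real mat"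
  assumes k: "0 < k" and \<alpha>: "0 < \<alpha>" and \<sigma>: "0 < \<sigma>"
    and X: "\<And>n. k \<le> n \<Longrightarrow> X n \<in> carrier_mat n k"
    and rank: "\<And>n. k \<le> n \<Longrightarrow> vec_space.rank n (X n) = k"
    and lim: "\<And>i j. i < k \<Longrightarrow> j < k \<Longrightarrow>
      (\<lambda>n. (transpose_mat (X n) * X n) $$ (i,j) / real n) \<longlonglongrightarrow> Q $$ (i,j)"
    and Q: "pos_def_mat k Q" and \<eta>: "0 < \<eta>"
  obtains M where "0 < M"
    "\<And>n \<beta> E. k \<le> n \<Longrightarrow> \<beta> \<in> carrier_vec k \<Longrightarrow>
       (\<And>Y. Y \<in> carrier_vec n \<Longrightarrow> E Y \<Longrightarrow> M \<le> sqrt (real n) * vnorm (betaT \<alpha> \<sigma> k1 (X n) Y - \<beta>)) \<Longrightarrow>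
       PrY n (X n) \<beta> \<sigma> E \<le> \<eta>"
proof -
  obtain c where c: "0 < c"
    "\<And>n v. k \<le> n \<Longrightarrow> v \<in> carrier_vec k \<Longrightarrow> c * real n * (v \<bullet> v) \<le> (X n *\<^sub>v v) \<bullet> (X n *\<^sub>v v)"
    using Gram_coercive_uniformly[OF k X rank lim Q] by blast
  define tr where "tr n = (\<Sum>j<k. (transpose_mat (X n) * X n) $$ (j,j))" for n
  have "(\<lambda>n. \<Sum>j<k. (transpose_mat (X n) * X n) $$ (j,j) / real n) \<longlonglongrightarrow> (\<Sum>j<k. Q $$ (j,j))"
    by (intro tendsto_sum lim) auto
  hence "(\<lambda>n. tr n / real n) \<longlonglongrightarrow> (\<Sum>j<k. Q $$ (j,j))"
    by (simp add: tr_def sum_divide_distrib)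
  hence "Bseq (\<lambda>n. tr n / real n)" by (intro convergent_imp_Bseq convergentI)
  then obtain T where T: "0 < T" "\<And>n. norm (tr n / real n) \<le> T" by (auto simp: Bseq_def)
  have tr_le: "tr n \<le> T * real n" if "0 < n" for n
    using T(2)[of n] that by (simp add: abs_le_iff field_simps)
  define K where "K = exp (2 * \<alpha> * real (k - k1)) * \<sigma>\<^sup>2 / \<alpha>"
  \<comment> \<open>\<open>t\<close> makes the Markov bound equal to \<eta>; M^2 is the
    deterministic error bound, scaled by n, when |X' u|^2 = n t.\<close>
  define t where "t = \<sigma>\<^sup>2 * T / \<eta>"
  define M where "M = sqrt (2 * K / c + 2 * t / c\<^sup>2)"
  have K: "0 < K" and t: "0 < t" using \<alpha> \<sigma> T \<eta> by (auto simp: K_def t_def)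
  have M: "0 < M" "M\<^sup>2 = 2 * K / c + 2 * t / c\<^sup>2"
    using K t c(1) by (auto simp: M_def add_pos_pos)
  show thesis
  proof (rule that[OF M(1)])
    fix n \<beta> and E :: "real vec \<Rightarrow> bool"
    assume n: "k \<le> n" and b: "\<beta> \<in> carrier_vec k"
      and E: "\<And>Y. Y \<in> carrier_vec n \<Longrightarrow> E Y \<Longrightarrow> M \<le> sqrt (real n) * vnorm (betaT \<alpha> \<sigma> k1 (X n) Y - \<beta>)"
    have n0: "0 < n" using n k by simp
    have "PrY n (X n) \<beta> \<sigma> E \<le> \<sigma>\<^sup>2 * (\<Sum>j<k. (transpose_mat (X n) * X n) $$ (j,j)) / (real n * t)"
    proof (rule PrY_score_Markov[OF \<sigma> X[OF n] b])
      show "0 < real n * t" using n0 t by simp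
      fix Y assume Y: "Y \<in> carrier_vec n" and "E Y"
      let ?z = "transpose_mat (X n) *\<^sub>v (Y - X n *\<^sub>v \<beta>)"
      have "M\<^sup>2 \<le> (sqrt (real n) * vnorm (betaT \<alpha> \<sigma> k1 (X n) Y - \<beta>))\<^sup>2"
        using E[OF Y \<open>E Y\<close>] M(1) by (intro power_mono) auto
      also have "\<dots> = real n * (vnorm (betaT \<alpha> \<sigma> k1 (X n) Y - \<beta>))\<^sup>2"
        by (simp add: power_mult_distrib)
      \<comment> \<open>The coercivity constant is now \<open>c * real n\<close>, so the factor n
        cancels in the deterministic part.\<close>
      also have "\<dots> \<le> real n * (2 * K / (c * real n) + 2 * (?z \<bullet> ?z) / (c * real n)\<^sup>2)"
        unfolding K_def using n0 c
        by (intro mult_left_mono betaT_error_bound[OF X[OF n] _ Y _ \<alpha> \<sigma> b] c(2) n) auto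
      also have "\<dots> = 2 * K / c + 2 * ((?z \<bullet> ?z) / real n) / c\<^sup>2"
        using n0 c(1) by (simp add: field_simps power2_eq_square)
      finally have "2 * t / c\<^sup>2 \<le> 2 * ((?z \<bullet> ?z) / real n) / c\<^sup>2" by (simp add: M(2))
      hence "t \<le> (?z \<bullet> ?z) / real n" using c(1) unfolding divide_le_cancel by simp
      thus "real n * t \<le> ?z \<bullet> ?z" using n0 by (simp add: field_simps)
    qed
    also have "\<dots> = \<sigma>\<^sup>2 * tr n / (real n * t)" by (simp add: tr_def)
    also have "\<dots> \<le> \<sigma>\<^sup>2 * (T * real n) / (real n * t)"
      using tr_le[OF n0] n0 t by (intro divide_right_mono mult_left_mono) auto
    also have "\<dots> = \<eta>" using n0 \<sigma> T \<eta> by (simp add: t_def)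
    finally show "PrY n (X n) \<beta> \<sigma> E \<le> \<eta>" .
  qed
qed

text \<open>A supremum of reals is informative only for a bounded nonempty set; the uniform bound
  supplies boundedness as well as smallness. Halving e restores strictness.\<close>

lemma tendsto_SUP_zero:
  fixes f :: "'a \<Rightarrow> 'b \<Rightarrow> real"
  assumes "B \<noteq> {}" and nonneg: "\<And>x b. 0 \<le> f x b"
    and small: "\<And>\<eta>. 0 < \<eta> \<Longrightarrow> \<forall>\<^sub>F x in F. \<forall>b\<in>B. f x b \<le> \<eta>"
  shows "((\<lambda>x. SUP b\<in>B. f x b) \<longlongrightarrow> 0) F"
proof (rule tendstoI)
  fix e :: real assume "0 < e"
  hence "\<forall>\<^sub>F x in F. \<forall>b\<in>B. f x b \<le> e / 2" by (intro small) auto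
  thus "\<forall>\<^sub>F x in F. dist (SUP b\<in>B. f x b) 0 < e"
  proof eventually_elim
    case (elim x)
    obtain b where b: "b \<in> B" using \<open>B \<noteq> {}\<close> by blast
    have "(SUP b\<in>B. f x b) \<le> e / 2" using elim \<open>B \<noteq> {}\<close> by (intro cSUP_least) auto
    moreover have "bdd_above (f x ` B)" using elim by (intro bdd_aboveI2[of _ _ "e / 2"]) auto
    hence "0 \<le> (SUP b\<in>B. f x b)" by (rule cSUP_upper2[OF _ b nonneg])
    ultimately show ?case using \<open>0 < e\<close> by (simp add: dist_real_def)
  qed
qed

text \<open>\<open>D\<close> is any discrepancy dominated by \<open>L\<close> times the error
  \<open>V\<close>, so both parts of the theorem are instances.\<close>

lemma tail_probabilities_vanish:
  fixes X :: "nat \<Rightarrow> real mat" and D :: "nat \<Rightarrow> real vec \<Rightarrow> real vec \<Rightarrow> real"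
  assumes L: "0 < L"
    and D: "\<And>n \<beta> Y. k \<le> n \<Longrightarrow> \<beta> \<in> carrier_vec k \<Longrightarrow> Y \<in> carrier_vec n \<Longrightarrow> D n \<beta> Y \<le> L * V n \<beta> Y"
    and \<sigma>: "0 < \<sigma>"
    and tight: "\<And>\<eta>. 0 < \<eta> \<Longrightarrow> \<exists>M>0. \<forall>n\<ge>k. \<forall>\<beta>\<in>carrier_vec k. \<forall>E.
      (\<forall>Y\<in>carrier_vec n. E Y \<longrightarrow> M \<le> sqrt (real n) * V n \<beta> Y) \<longrightarrow> PrY n (X n) \<beta> \<sigma> E \<le> \<eta>"
  shows "((\<lambda>M. SUP n\<in>{k..}. SUP \<beta>\<in>carrier_vec k.
      PrY n (X n) \<beta> \<sigma> (\<lambda>Y. sqrt (real n) * D n \<beta> Y \<ge> M)) \<longlongrightarrow> 0) at_top"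
    and "\<And>\<epsilon> c. 0 < \<epsilon> \<Longrightarrow> (\<And>n. 0 \<le> c n) \<Longrightarrow> c \<in> o(\<lambda>n. sqrt (real n)) \<Longrightarrow>
      (\<lambda>n. SUP \<beta>\<in>carrier_vec k. PrY n (X n) \<beta> \<sigma> (\<lambda>Y. c n * D n \<beta> Y \<ge> \<epsilon>)) \<longlonglongrightarrow> 0"
proof -
  have ne: "carrier_vec k \<noteq> ({} :: real vec set)" using zero_carrier_vec by blast
  show "((\<lambda>M. SUP n\<in>{k..}. SUP \<beta>\<in>carrier_vec k.
      PrY n (X n) \<beta> \<sigma> (\<lambda>Y. sqrt (real n) * D n \<beta> Y \<ge> M)) \<longlongrightarrow> 0) at_top"
  proof (rule tendsto_SUP_zero)
    fix M n
    \<comment> \<open>Nonnegativity is required for every \<open>n\<close>, including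
      \<open>n < k\<close>; the bound 1 on probabilities holds there too.\<close>
    have "bdd_above ((\<lambda>\<beta>. PrY n (X n) \<beta> \<sigma> (\<lambda>Y. sqrt (real n) * D n \<beta> Y \<ge> M)) ` carrier_vec k)"
      by (intro bdd_aboveI2[of _ _ 1] PrY_le_1 \<sigma>)
    thus "0 \<le> (SUP \<beta>\<in>carrier_vec k. PrY n (X n) \<beta> \<sigma> (\<lambda>Y. sqrt (real n) * D n \<beta> Y \<ge> M))"
      by (rule cSUP_upper2[OF _ zero_carrier_vec PrY_nonneg])
  next
    fix \<eta> :: real assume "0 < \<eta>"
    then obtain M0 where M0: "0 < M0" "\<And>n \<beta> E. k \<le> n \<Longrightarrow> \<beta> \<in> carrier_vec k \<Longrightarrow>
      (\<forall>Y\<in>carrier_vec n. E Y \<longrightarrow> M0 \<le> sqrt (real n) * V n \<beta> Y) \<Longrightarrow> PrY n (X n) \<beta> \<sigma> E \<le> \<eta>"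
      using tight by meson
    show "\<forall>\<^sub>F M in at_top. \<forall>n\<in>{k..}. (SUP \<beta>\<in>carrier_vec k.
        PrY n (X n) \<beta> \<sigma> (\<lambda>Y. sqrt (real n) * D n \<beta> Y \<ge> M)) \<le> \<eta>"
      \<comment> \<open>Beyond this level the event for \<open>D\<close> forces the event for
        \<open>V\<close> at level \<open>M0\<close>.\<close>
      using eventually_ge_at_top[of "L * M0"]
    proof (eventually_elim, intro ballI cSUP_least[OF ne] M0(2) impI)
      fix M n \<beta> Y
      assume M: "L * M0 \<le> M" and "n \<in> {k..}" "\<beta> \<in> carrier_vec k" "Y \<in> carrier_vec n"
        and "M \<le> sqrt (real n) * D n \<beta> Y"
      moreover have "sqrt (real n) * D n \<beta> Y \<le> sqrt (real n) * (L * V n \<beta> Y)"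
        using calculation by (intro mult_left_mono D) auto
      ultimately have "L * M0 \<le> L * (sqrt (real n) * V n \<beta> Y)" by (simp add: mult_ac)
      thus "M0 \<le> sqrt (real n) * V n \<beta> Y" using L by simp
    qed auto
  qed auto
next
  fix \<epsilon> :: real and c :: "nat \<Rightarrow> real"
  assume \<epsilon>: "0 < \<epsilon>" and c: "\<And>n. 0 \<le> c n" and o: "c \<in> o(\<lambda>n. sqrt (real n))"
  have ne: "carrier_vec k \<noteq> ({} :: real vec set)" using zero_carrier_vec by blast
  show "(\<lambda>n. SUP \<beta>\<in>carrier_vec k. PrY n (X n) \<beta> \<sigma> (\<lambda>Y. c n * D n \<beta> Y \<ge> \<epsilon>)) \<longlonglongrightarrow> 0"
  proof (rule tendsto_SUP_zero[OF ne PrY_nonneg])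
    fix \<eta> :: real assume "0 < \<eta>"
    then obtain M0 where M0: "0 < M0" "\<And>n \<beta> E. k \<le> n \<Longrightarrow> \<beta> \<in> carrier_vec k \<Longrightarrow>
      (\<forall>Y\<in>carrier_vec n. E Y \<longrightarrow> M0 \<le> sqrt (real n) * V n \<beta> Y) \<Longrightarrow> PrY n (X n) \<beta> \<sigma> E \<le> \<eta>"
      using tight by meson
    \<comment> \<open>With c_n \<le> \<delta> sqrt n, the event c_n D \<ge> \<epsilon> forces sqrt n
      V \<ge> \<epsilon> / (\<delta> L) = M0.\<close>
    define \<delta> where "\<delta> = \<epsilon> / (L * M0)"
    have \<delta>: "0 < \<delta>" using \<epsilon> L M0 by (simp add: \<delta>_def)
    have "\<forall>\<^sub>F n in sequentially. norm (c n) \<le> \<delta> * norm (sqrt (real n))"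
      by (rule landau_o.smallD[OF o \<delta>])
    thus "\<forall>\<^sub>F n in sequentially. \<forall>\<beta>\<in>carrier_vec k. PrY n (X n) \<beta> \<sigma> (\<lambda>Y. c n * D n \<beta> Y \<ge> \<epsilon>) \<le> \<eta>"
      using eventually_ge_at_top[of k]
    proof (eventually_elim, intro ballI M0(2) impI)
      fix n \<beta> Y
      assume cn: "norm (c n) \<le> \<delta> * norm (sqrt (real n))" and "k \<le> n" "\<beta> \<in> carrier_vec k" "Y \<in> carrier_vec n"
        and "\<epsilon> \<le> c n * D n \<beta> Y"
      moreover have "c n * D n \<beta> Y \<le> c n * (L * V n \<beta> Y)"
        using calculation c by (intro mult_left_mono D) auto
      ultimately have le: "\<epsilon> \<le> c n * (L * V n \<beta> Y)" by linarith
      \<comment> \<open>\<open>V\<close> carries no sign assumption here; positivity on the event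
        allows c_n to be replaced by its upper bound.\<close>
      hence "0 < L * V n \<beta> Y" using \<epsilon> c[of n] by (smt (verit) mult_nonneg_nonpos)
      hence "c n * (L * V n \<beta> Y) \<le> \<delta> * sqrt (real n) * (L * V n \<beta> Y)"
        using cn by (intro mult_right_mono) auto
      hence "\<epsilon> \<le> \<delta> * sqrt (real n) * (L * V n \<beta> Y)" using le by linarith
      also have "\<dots> = \<epsilon> / M0 * (sqrt (real n) * V n \<beta> Y)" using L by (simp add: \<delta>_def)
      finally show "M0 \<le> sqrt (real n) * V n \<beta> Y" using \<epsilon> M0(1) by (simp add: field_simps)
    qed auto
  qed
qed

lemma vnorm_mult_mat_vec_le:
  assumes A: "A \<in> carrier_mat m k" and k: "0 < k" and v: "v \<in> carrier_vec k"
    and B: "lambda_max (transpose_mat A * A) \<le> B"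
  shows "vnorm (A *\<^sub>v v) \<le> sqrt B * vnorm v"
proof -
  have "(A *\<^sub>v v) \<bullet> (A *\<^sub>v v) \<le> lambda_max (transpose_mat A * A) * (v \<bullet> v)"
    by (rule scalar_prod_mult_mat_vec_le_lambda_max[OF A k v])
  also have "\<dots> \<le> B * (v \<bullet> v)" by (intro mult_right_mono B scalar_prod_self_nonneg)
  finally show ?thesis by (simp add: vnorm_def flip: real_sqrt_mult)
qed

theorem theorem5:
  fixes X :: "nat \<Rightarrow> real mat" and k k1 :: nat and \<alpha> \<sigma> :: real and Q :: "real mat"
  assumes "k > 1" and "1 \<le> k1" and "k1 < k"
    and "\<sigma> > 0" and "\<alpha> > 0"
    and "\<forall>n\<ge>k. X n \<in> carrier_mat n k \<and> vec_space.rank n (X n :: real mat) = k"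
    and "Q \<in> carrier_mat k k"
    and "\<forall>i<k. \<forall>j<k. (\<lambda>n. (transpose_mat (X n) * X n) $$ (i,j) / real n) \<longlonglongrightarrow> Q $$ (i,j)"
    and "pos_def_mat k Q"
  shows
    "((\<lambda>M. SUP n\<in>{k..}. SUP \<beta>\<in>carrier_vec k.
          PrY n (X n) \<beta> \<sigma> (\<lambda>Y. sqrt (real n) * vnorm (betaT \<alpha> \<sigma> k1 (X n) Y - \<beta>) \<ge> M))
       \<longlongrightarrow> 0) at_top
     \<and> (\<forall>\<epsilon>>0. \<forall>c :: nat \<Rightarrow> real. (\<forall>n. c n \<ge> 0) \<longrightarrow> c \<in> o(\<lambda>n. sqrt (real n)) \<longrightarrow>
          (\<lambda>n. SUP \<beta>\<in>carrier_vec k.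
             PrY n (X n) \<beta> \<sigma> (\<lambda>Y. c n * vnorm (betaT \<alpha> \<sigma> k1 (X n) Y - \<beta>) \<ge> \<epsilon>))
          \<longlonglongrightarrow> 0)
     \<and> (\<forall>(A :: nat \<Rightarrow> real mat) (p :: nat \<Rightarrow> nat).
          (\<forall>n. A n \<in> carrier_mat (p n) k) \<longrightarrow>
          (\<exists>B. \<forall>n. lambda_max (transpose_mat (A n) * A n) \<le> B) \<longrightarrow>
          ((\<lambda>M. SUP n\<in>{k..}. SUP \<beta>\<in>carrier_vec k.
              PrY n (X n) \<beta> \<sigma>
                (\<lambda>Y. sqrt (real n) * vnorm (A n *\<^sub>v betaT \<alpha> \<sigma> k1 (X n) Y - A n *\<^sub>v \<beta>) \<ge> M))
            \<longlongrightarrow> 0) at_top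
          \<and> (\<forall>\<epsilon>>0. \<forall>c :: nat \<Rightarrow> real. (\<forall>n. c n \<ge> 0) \<longrightarrow> c \<in> o(\<lambda>n. sqrt (real n)) \<longrightarrow>
              (\<lambda>n. SUP \<beta>\<in>carrier_vec k.
                 PrY n (X n) \<beta> \<sigma>
                   (\<lambda>Y. c n * vnorm (A n *\<^sub>v betaT \<alpha> \<sigma> k1 (X n) Y - A n *\<^sub>v \<beta>) \<ge> \<epsilon>))
              \<longlonglongrightarrow> 0))"
proof -
  have k: "0 < k" using assms(1) by simp
  have X: "X n \<in> carrier_mat n k" "vec_space.rank n (X n) = k" if "k \<le> n" for n
    using assms(6) that by auto
  have lim: "(\<lambda>n. (transpose_mat (X n) * X n) $$ (i,j) / real n) \<longlonglongrightarrow> Q $$ (i,j)" if "i < k" "j < k" for i j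
    using assms(8) that by blast
  define V where "V n \<beta> Y = vnorm (betaT \<alpha> \<sigma> k1 (X n) Y - \<beta>)" for n \<beta> Y
  have tight: "\<exists>M>0. \<forall>n\<ge>k. \<forall>\<beta>\<in>carrier_vec k. \<forall>E.
      (\<forall>Y\<in>carrier_vec n. E Y \<longrightarrow> M \<le> sqrt (real n) * V n \<beta> Y) \<longrightarrow> PrY n (X n) \<beta> \<sigma> E \<le> \<eta>"
    if "0 < \<eta>" for \<eta>
    unfolding V_def
    by (rule betaT_uniformly_tight[OF k assms(5,4) X lim assms(9) that, of k1]) blast+
  note vanish = tail_probabilities_vanish[where V = V, OF _ _ assms(4) tight]
  \<comment> \<open>The dimension is needed to distribute \<open>A n\<close> over the difference
    with \<beta>.\<close>
  have T: "betaT \<alpha> \<sigma> k1 (X n) Y \<in> carrier_vec k" if "k \<le> n" "Y \<in> carrier_vec n" for n Y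
  proof -
    obtain c where c: "0 < c"
      "\<And>n v. k \<le> n \<Longrightarrow> v \<in> carrier_vec k \<Longrightarrow> c * real n * (v \<bullet> v) \<le> (X n *\<^sub>v v) \<bullet> (X n *\<^sub>v v)"
      using Gram_coercive_uniformly[OF k X lim assms(9)] by blast
    have "betaU (X n) Y \<in> carrier_vec k"
      using c(1) that k by (intro betaU_carrier[OF X(1) _ _ c(2)]) auto
    moreover have "betaR k1 (X n) Y \<in> carrier_vec k" using X[OF that(1)] by (auto simp: betaR_def Let_def)
    ultimately show ?thesis by (simp add: betaT_def)
  qed
  \<comment> \<open>The maximum with 1 makes the factor strictly positive, as \<open>L\<close> must
    be.\<close>
  have AV: "vnorm (A n *\<^sub>v betaT \<alpha> \<sigma> k1 (X n) Y - A n *\<^sub>v \<beta>) \<le> sqrt (max B 1) * V n \<beta> Y"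
    if A: "\<And>n. A n \<in> carrier_mat (p n) k" and B: "\<And>n. lambda_max (transpose_mat (A n) * A n) \<le> B"
      and "k \<le> n" "\<beta> \<in> carrier_vec k" "Y \<in> carrier_vec n" for A p B n \<beta> Y
  proof -
    have "A n *\<^sub>v betaT \<alpha> \<sigma> k1 (X n) Y - A n *\<^sub>v \<beta> = A n *\<^sub>v (betaT \<alpha> \<sigma> k1 (X n) Y - \<beta>)"
      using A T[OF that(3,5)] that(4) by (intro mult_minus_distrib_mat_vec[symmetric])
    thus ?thesis
      unfolding V_def using A[of n] B[of n] k T[OF that(3,5)] that(4)
      by (auto intro!: vnorm_mult_mat_vec_le max.coboundedI1)
  qed
  show ?thesis
  proof (intro conjI allI impI, goal_cases)
    case 1
    show ?case unfolding V_def[symmetric] by (rule vanish(1)[where L = 1]) simp_all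
  next
    case (2 \<epsilon> c)
    show ?case unfolding V_def[symmetric] by (rule vanish(2)[where L = 1]) (use 2 in simp_all)
  next
    case (3 A p)
    then obtain B where B: "\<And>n. lambda_max (transpose_mat (A n) * A n) \<le> B" by blast
    note DV = AV[OF 3(1)[rule_format] B]
    show ?case by (rule vanish(1)[where L = "sqrt (max B 1)"]) (use DV in auto)
  next
    case (4 A p \<epsilon> c)
    then obtain B where B: "\<And>n. lambda_max (transpose_mat (A n) * A n) \<le> B" by blast
    note DV = AV[OF 4(1)[rule_format] B]
    show ?case by (rule vanish(2)[where L = "sqrt (max B 1)"]) (use DV 4 in auto)
  qed
qed

end
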